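(* Let $n,m,k,r$ be integers with $n\geq m\geq k\geq1$ and $r\geq2$. Let $Z=\{z_1,\dots,z_n\}$ be a multiset of integers. Define $\gamma\colon\binom{[n]}{k}\to[r]$ by $\gamma(S)=1+\left(\left(\sum_{i\in S}z_i\right)\bmod r\right)$. Let $\beta,\zeta\in[0,1]$ be arbitrary. Then $\gamma$ is $(\epsilon,\delta,m)$-balanced, where \[ \epsilon=4r^2k\exp\left(-\frac{\lfloor m/k\rfloor\zeta^2}{8}\right)+r(\mathrm{disc}_r(Z)+\beta+\zeta)^k,\qquad \delta=4r\exp\left(-\frac{m\beta^2}{8}\right). \]
   Context: $[n]=\{1,\dots,n\}$, $\binom{S}{k}$ is the family of $k$-element subsets of $S$, and $a\bmod r\in\{0,\dots,r-1\}$. $\mathrm{disc}_r(Z)=\max_{j=1,\dots,r-1}\left|\frac1n\sum_{i=1}^n\omega^{jz_i}\right|$ with $\omega$ a primitive $r$-th root of unity. A coloring $\gamma\colon\binom{[n]}{k}\to[r]$ is $\epsilon$-balanced on $A\subseteq[n]$ if for each $i\in[r]$, $\frac{1-\epsilon}{r}\binom{|A|}{k}\leq|\gamma^{-1}(i)\cap\binom{A}{k}|\leq\frac{1+\epsilon}{r}\binom{|A|}{k}$; it is $(\epsilon,\delta,m)$-balanced if for every $\ell\in\{m,\dots,n\}$, a uniformly random $A\in\binom{[n]}{\ell}$ satisfies $\Pr[\gamma\text{ is }\epsilon\text{-balanced on }A]\geq1-\delta$. *)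

theory Defs
  imports "HOL-Probability.Probability" "HOL-Library.Ramsey"
begin

text \<open>
  The family of \<open>k\<close>-element subsets of \<open>S\<close> is \<^term>\<open>nsets S k\<close>. A multiset \<open>{z\<^sub>1, \<dots>, z\<^sub>n}\<close> of
  integers is an arbitrary \<open>z :: nat \<Rightarrow> int\<close>, of which only the values on \<open>{1..n}\<close> matter.
\<close>

definition primitive_root_of_unity :: "nat \<Rightarrow> complex \<Rightarrow> bool" where
  "primitive_root_of_unity r \<omega> \<longleftrightarrow> \<omega> ^ r = 1 \<and> (\<forall>j\<in>{1..<r}. \<omega> ^ j \<noteq> 1)"

text \<open>The root \<open>\<omega>\<close> is a parameter; the value is the same for all primitive \<open>r\<close>-th roots of unity.\<close>

definition disc :: "nat \<Rightarrow> complex \<Rightarrow> nat \<Rightarrow> (nat \<Rightarrow> int) \<Rightarrow> real" where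
  "disc r \<omega> n z =
     (MAX j\<in>{1..r-1}. cmod (1 / of_nat n * (\<Sum>i=1..n. \<omega> powi (int j * z i))))"

definition sum_coloring :: "nat \<Rightarrow> (nat \<Rightarrow> int) \<Rightarrow> nat set \<Rightarrow> nat" where
  "sum_coloring r z S = 1 + nat ((\<Sum>i\<in>S. z i) mod int r)"

lemma sum_coloring_in_range:
  assumes "r > 0"
  shows "sum_coloring r z S \<in> {1..r}"
proof -
  have "nat ((\<Sum>i\<in>S. z i) mod int r) < r"
    using assms by (simp add: nat_less_iff)
  then show ?thesis by (simp add: sum_coloring_def)
qed

text \<open>
  A coloring \<open>nsets {1..n} k \<rightarrow> {1..r}\<close> is a total function on sets of naturals; the two notions
  below inspect it only on \<open>k\<close>-element subsets of \<open>{1..n}\<close> (for \<open>A \<subseteq> {1..n}\<close>).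
\<close>

definition balanced_on ::
    "nat \<Rightarrow> nat \<Rightarrow> (nat set \<Rightarrow> nat) \<Rightarrow> real \<Rightarrow> nat set \<Rightarrow> bool" where
  "balanced_on k r \<gamma> \<epsilon> A \<longleftrightarrow>
     (\<forall>i\<in>{1..r}.
        (1 - \<epsilon>) / real r * real (card A choose k) \<le> real (card (\<gamma> -` {i} \<inter> nsets A k)) \<and>
        real (card (\<gamma> -` {i} \<inter> nsets A k)) \<le> (1 + \<epsilon>) / real r * real (card A choose k))"

definition balanced ::
    "nat \<Rightarrow> nat \<Rightarrow> nat \<Rightarrow> (nat set \<Rightarrow> nat) \<Rightarrow> real \<Rightarrow> real \<Rightarrow> nat \<Rightarrow> bool" where
  "balanced n k r \<gamma> \<epsilon> \<delta> m \<longleftrightarrow>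
     (\<forall>l\<in>{m..n}.
        measure_pmf.prob (pmf_of_set (nsets {1..n} l)) {A. balanced_on k r \<gamma> \<epsilon> A} \<ge> 1 - \<delta>)"

end

theory Submission
  imports Defs
begin

text \<open>
  By discrete Fourier inversion on \<open>\<int>/r\<close>, the coloring is nearly balanced on \<open>A\<close> as soon as, for
  \<open>0 < j < r\<close> and \<open>w\<^sub>i = \<omega> powi (j z\<^sub>i)\<close>, the average of \<open>\<Prod>i\<in>S. w\<^sub>i\<close> over the \<open>k\<close>-subsets \<open>S\<close> of \<open>A\<close> is small.
  That average equals the average, over random disjoint blocks in \<open>A\<close> of size \<open>\<lfloor>|A|/k\<rfloor>\<close>, of the
  product of the \<open>k\<close> block means. Hoeffding's inequality for sampling without replacement is used
  twice: the mean of \<open>w\<close> over a random \<open>A\<close> is at most \<open>disc + \<beta>\<close>, and a block mean exceeds the mean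
  over \<open>A\<close> by more than \<open>\<zeta>\<close> only rarely; each factor being at most 1, a rare bad block costs only
  its probability.
\<close>

section \<open>Maclaurin's inequality for elementary symmetric sums\<close>

lemma nsets_insert:
  assumes "a \<notin> A"
  shows "nsets (insert a A) (Suc l) = nsets A (Suc l) \<union> insert a ` nsets A l"
proof (intro equalityI subsetI)
  fix S assume S: "S \<in> nsets (insert a A) (Suc l)"
  show "S \<in> nsets A (Suc l) \<union> insert a ` nsets A l"
  proof (cases "a \<in> S")
    case True
    then have "S = insert a (S - {a})" "S - {a} \<in> nsets A l"
      using S by (auto simp: nsets_def)
    then show ?thesis by blast
  next
    case False
    then show ?thesis using S by (auto simp: nsets_def)
  qed
next
  fix S assume "S \<in> nsets A (Suc l) \<union> insert a ` nsets A l"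
  then show "S \<in> nsets (insert a A) (Suc l)"
    using assms by (auto simp: nsets_def card_insert_if)
qed

lemma sum_nsets_insert:
  fixes F :: "'a set \<Rightarrow> 'b::comm_monoid_add"
  assumes "finite A" "a \<notin> A"
  shows "(\<Sum>S\<in>nsets (insert a A) (Suc l). F S)
           = (\<Sum>S\<in>nsets A (Suc l). F S) + (\<Sum>S\<in>nsets A l. F (insert a S))"
proof -
  have "inj_on (insert a) (nsets A l)"
    using assms by (auto simp: inj_on_def nsets_def)
  moreover have "nsets A (Suc l) \<inter> insert a ` nsets A l = {}"
    using assms by (auto simp: nsets_def)
  ultimately show ?thesis
    using assms(2) finite_imp_finite_nsets[OF assms(1)]
    by (simp add: nsets_insert sum.union_disjoint sum.reindex)
qed

text \<open>Adding one element to \<open>A\<close> turns the claim into Bernoulli's inequality.\<close>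

lemma Maclaurin_inequality:
  fixes x :: "'a \<Rightarrow> real"
  assumes "finite A" "\<And>a. a \<in> A \<Longrightarrow> x a > 0"
  shows "(\<Sum>S\<in>nsets A l. \<Prod>a\<in>S. x a) \<le> real (card A choose l) * ((\<Sum>a\<in>A. x a) / card A) ^ l"
  using assms
proof (induction A arbitrary: l rule: finite_induct)
  case empty
  then show ?case by (cases l) (auto simp: nsets_empty_iff)
next
  case (insert a A)
  show ?case
  \<comment> \<open>The recursion needs \<open>l\<close> positive and the mean over the old set
    needs \<open>A\<close> nonempty, so both degenerate cases are settled first.\<close>
  proof (cases "l = 0 \<or> A = {}")
    case True
    then show ?thesis
    proof
      assume "A = {}"
      then show ?thesis
        using insert.prems
        by (auto simp: nsets_singleton_iff intro!: mult_nonneg_nonneg zero_le_power less_imp_le)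
    qed auto
  next
    case False
    then obtain k where l: "l = Suc k" by (cases l) auto
    define n where "n = card A"
    have n: "n > 0" using False insert.hyps by (auto simp: n_def card_gt_0_iff)
    define \<mu> where "\<mu> = (\<Sum>a\<in>A. x a) / n"
    have \<mu>: "\<mu> > 0"
      unfolding \<mu>_def using n False insert by (intro divide_pos_pos sum_pos) auto
    have xa: "x a > 0" using insert.prems by auto
    \<comment> \<open>\<open>u\<close> is the relative change of the mean when \<open>a\<close>
      joins \<open>A\<close>: the new mean is \<open>\<mu> * (1 + u)\<close>. The bound
      \<open>u \<ge> -1\<close> required by Bernoulli's inequality then says that the new mean is
      nonnegative.\<close>
    define u where "u = (x a - \<mu>) / ((n + 1) * \<mu>)"
    have xa_eq: "x a - \<mu> = (n + 1) * (u * \<mu>)"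
      using \<mu> by (simp add: u_def)
    then have u1: "\<mu> * (1 + u) = (n * \<mu> + x a) / (n + 1)"
      by (simp add: field_simps)
    have u: "u \<ge> -1"
    proof -
      have "\<mu> * (1 + u) \<ge> 0" unfolding u1 using \<mu> xa by simp
      then show ?thesis using \<mu> by (simp add: zero_le_mult_iff)
    qed
    have prod_ins: "(\<Prod>b\<in>insert a S. x b) = x a * (\<Prod>b\<in>S. x b)" if "S \<in> nsets A k" for S
      using that insert.hyps by (subst prod.insert) (auto simp: nsets_def)
    have "(\<Sum>S\<in>nsets (insert a A) l. \<Prod>b\<in>S. x b)
        = (\<Sum>S\<in>nsets A l. \<Prod>b\<in>S. x b) + x a * (\<Sum>S\<in>nsets A k. \<Prod>b\<in>S. x b)"
      using insert.hyps by (simp add: l sum_nsets_insert prod_ins sum_distrib_left)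
    also have "\<dots> \<le> real (n choose l) * \<mu> ^ l + x a * (real (n choose k) * \<mu> ^ k)"
      using insert.IH[of l] insert.IH[of k] insert.prems xa
      by (intro add_mono mult_left_mono) (auto simp: n_def \<mu>_def less_imp_le)
    also have "\<dots> = real (Suc n choose l) * (\<mu> ^ l * (1 + real l * u))"
    proof -
      \<comment> \<open>The absorption identity turns the coefficient of \<open>u\<close> into
        \<open>l\<close> times the common binomial factor, which is exactly the linear term in
        Bernoulli's inequality.\<close>
      have 1: "real (n choose k) * (n + 1) = real (Suc n choose l) * l"
        using Suc_times_binomial_eq[of n k]
        unfolding l by (simp del: binomial_Suc_Suc add: algebra_simps flip: of_nat_mult of_nat_Suc of_nat_add)
      have 2: "real (n choose l) = real (Suc n choose l) - real (n choose k)"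
        by (simp add: l)
      have "(n choose l) * \<mu> ^ l + x a * ((n choose k) * \<mu> ^ k)
          = \<mu> ^ k * (real (Suc n choose l) * \<mu> + real (n choose k) * (x a - \<mu>))"
        unfolding 2 by (simp add: l algebra_simps)
      also have "real (n choose k) * (x a - \<mu>) = (real (n choose k) * (n + 1)) * (u * \<mu>)"
        unfolding xa_eq by (simp only: mult_ac)
      finally show ?thesis unfolding 1 by (simp add: l algebra_simps)
    qed
    also have "\<dots> \<le> real (Suc n choose l) * (\<mu> ^ l * (1 + u) ^ l)"
      using Bernoulli_inequality[OF u, of l] \<mu> by (intro mult_left_mono) auto
    also have "\<mu> ^ l * (1 + u) ^ l = ((n * \<mu> + x a) / (n + 1)) ^ l"
      by (simp only: flip: u1 power_mult_distrib)
    also have "n * \<mu> + x a = (\<Sum>b\<in>insert a A. x b)"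
      using n insert.hyps by (simp add: \<mu>_def)
    finally show ?thesis using insert.hyps by (simp add: n_def add.commute)
  qed
qed

section \<open>Concentration for sampling without replacement\<close>

text \<open>Hoeffding's lemma for the uniform distribution on \<open>A\<close>: the values lie in an
  interval of length 2, so the exponent \<open>t\<^sup>2 * 2\<^sup>2 / 8\<close> is
  \<open>t\<^sup>2 / 2\<close>.\<close>

lemma mean_exp_centered_le:
  fixes f :: "'a \<Rightarrow> real"
  assumes "finite A" "A \<noteq> {}" "\<And>a. a \<in> A \<Longrightarrow> \<bar>f a\<bar> \<le> 1" "t \<ge> 0"
  defines "\<mu> \<equiv> (\<Sum>a\<in>A. f a) / card A"
  shows "(\<Sum>a\<in>A. exp (t * (f a - \<mu>))) / card A \<le> exp (t\<^sup>2 / 2)"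
proof (cases "t = 0")
  case True
  then show ?thesis using assms by simp
next
  case False
  interpret interval_bounded_random_variable "measure_pmf (pmf_of_set A)" f "-1" 1
    by unfold_locales (use assms in \<open>auto simp: AE_measure_pmf_iff abs_le_iff minus_le_iff\<close>)
  have E: "measure_pmf.expectation (pmf_of_set A) f = \<mu>"
    using assms by (simp add: integral_pmf_of_set \<mu>_def)
  have "ennreal ((\<Sum>a\<in>A. exp (t * (f a - \<mu>))) / card A)
      = nn_integral (measure_pmf (pmf_of_set A)) (\<lambda>x. exp (t * (f x - \<mu>)))"
    using assms by (subst nn_integral_pmf_of_set)
      (auto simp: divide_ennreal ennreal_of_nat_eq_real_of_nat sum_nonneg card_gt_0_iff)
  also have "\<dots> \<le> ennreal (exp (t\<^sup>2 * (1 - (-1))\<^sup>2 / 8))"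
    using Hoeffdings_lemma_nn_integral[of t] False assms(4) unfolding E by simp
  finally show ?thesis by simp
qed

text \<open>
  Maclaurin's inequality bounds the moment generating function of a sum over a random \<open>b\<close>-subset
  by that of a sum of \<open>b\<close> independent samples, so the usual Chernoff argument applies.
\<close>

lemma Hoeffding_without_replacement:
  fixes f :: "'a \<Rightarrow> real"
  assumes "finite A" "A \<noteq> {}" "\<And>a. a \<in> A \<Longrightarrow> \<bar>f a\<bar> \<le> 1" "t \<ge> 0"
  defines "\<mu> \<equiv> (\<Sum>a\<in>A. f a) / card A"
  shows "real (card {B \<in> nsets A b. (\<Sum>a\<in>B. f a) \<ge> b * (\<mu> + t)})
           \<le> exp (- (b * t\<^sup>2 / 2)) * (card A choose b)"
proof -
  let ?X = "{B \<in> nsets A b. (\<Sum>a\<in>B. f a) \<ge> b * (\<mu> + t)}"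
  have fin: "finite (nsets A b)" using assms by (simp add: finite_imp_finite_nsets)
  \<comment> \<open>Markov's inequality with exponential parameter equal to the deviation
    \<open>t\<close>: this is the minimiser of \<open>s\<^sup>2 / 2 - s * t\<close> over
    \<open>s\<close>, and it leaves \<open>- t\<^sup>2 / 2\<close> per sampled element.\<close>
  have "exp (b * t\<^sup>2) * card ?X = (\<Sum>B\<in>?X. exp (b * t\<^sup>2))" by simp
  also have "\<dots> \<le> (\<Sum>B\<in>?X. \<Prod>a\<in>B. exp (t * (f a - \<mu>)))"
  proof (rule sum_mono)
    fix B assume B: "B \<in> ?X"
    then have "finite B" "card B = b" by (auto simp: nsets_def)
    then have eq: "(\<Prod>a\<in>B. exp (t * (f a - \<mu>))) = exp (t * ((\<Sum>a\<in>B. f a) - b * \<mu>))"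
      by (simp add: sum_subtractf flip: exp_sum sum_distrib_left)
    have "t * (b * t) \<le> t * ((\<Sum>a\<in>B. f a) - b * \<mu>)"
      using B assms(4) by (intro mult_left_mono) (auto simp: algebra_simps)
    then show "exp (b * t\<^sup>2) \<le> (\<Prod>a\<in>B. exp (t * (f a - \<mu>)))"
      unfolding eq by (simp add: power2_eq_square mult_ac)
  qed
  also have "\<dots> \<le> (\<Sum>B\<in>nsets A b. \<Prod>a\<in>B. exp (t * (f a - \<mu>)))"
    using fin by (intro sum_mono2) (auto intro: prod_nonneg)
  also have "\<dots> \<le> (card A choose b) * ((\<Sum>a\<in>A. exp (t * (f a - \<mu>))) / card A) ^ b"
    using assms by (intro Maclaurin_inequality) auto
  also have "\<dots> \<le> (card A choose b) * exp (t\<^sup>2 / 2) ^ b"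
    using mean_exp_centered_le[OF assms(1-4)]
    by (intro mult_left_mono power_mono) (auto simp: \<mu>_def intro!: divide_nonneg_nonneg sum_nonneg)
  also have "exp (t\<^sup>2 / 2) ^ b = exp (b * t\<^sup>2) * exp (- (b * t\<^sup>2 / 2))"
    by (simp flip: exp_of_nat_mult exp_add)
  finally show ?thesis by (simp add: mult_ac)
qed

text \<open>A complex deviation above \<open>t\<close> forces the real or the imaginary part to
  deviate by at least \<open>t / 2\<close>, upwards or downwards. The four real tails account for
  the factor 4, and halving \<open>t\<close> turns the exponent \<open>b * t\<^sup>2 / 2\<close>
  into \<open>b * t\<^sup>2 / 8\<close>.\<close>

lemma complex_Hoeffding_without_replacement:
  fixes w :: "'a \<Rightarrow> complex"
  assumes "finite A" "A \<noteq> {}" "\<And>a. a \<in> A \<Longrightarrow> cmod (w a) \<le> 1" "t \<ge> 0" "b > 0"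
  shows "real (card {B \<in> nsets A b. cmod ((\<Sum>a\<in>B. w a) / b) > cmod ((\<Sum>a\<in>A. w a) / card A) + t})
           \<le> 4 * exp (- (b * t\<^sup>2 / 8)) * (card A choose b)"
proof -
  define X where "X f = {B \<in> nsets A b. (\<Sum>a\<in>B. f a) \<ge> b * ((\<Sum>a\<in>A. f a) / card A + t / 2)}"
    for f :: "'a \<Rightarrow> real"
  let ?Y = "{B \<in> nsets A b. cmod ((\<Sum>a\<in>B. w a) / b) > cmod ((\<Sum>a\<in>A. w a) / card A) + t}"
  have fin: "finite (X f)" for f using assms by (simp add: finite_imp_finite_nsets X_def)
  have X: "card (X f) \<le> exp (- (b * t\<^sup>2 / 8)) * (card A choose b)"
    if "\<And>a. a \<in> A \<Longrightarrow> \<bar>f a\<bar> \<le> cmod (w a)" for f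
  proof -
    have "\<bar>f a\<bar> \<le> 1" if "a \<in> A" for a
      using assms(3)[OF that] \<open>\<And>a. a \<in> A \<Longrightarrow> \<bar>f a\<bar> \<le> cmod (w a)\<close>[OF that] by linarith
    then show ?thesis
      using Hoeffding_without_replacement[OF assms(1,2), of f "t / 2" b] assms(4)
      by (simp add: X_def power_divide)
  qed
  let ?re = "\<lambda>a. Re (w a)" and ?im = "\<lambda>a. Im (w a)"
  have "?Y \<subseteq> (X ?re \<union> X (\<lambda>a. - ?re a)) \<union> (X ?im \<union> X (\<lambda>a. - ?im a))"
  proof
    fix B assume B: "B \<in> ?Y"
    define D where "D = (\<Sum>a\<in>B. w a) / b - (\<Sum>a\<in>A. w a) / card A"
    have "t < cmod D"
      using B norm_triangle_ineq2[of "(\<Sum>a\<in>B. w a) / b" "(\<Sum>a\<in>A. w a) / card A"]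
      by (auto simp: D_def)
    also have "\<dots> \<le> \<bar>Re D\<bar> + \<bar>Im D\<bar>" by (rule cmod_le)
    finally have "t / 2 \<le> Re D \<or> t / 2 \<le> - Re D \<or> t / 2 \<le> Im D \<or> t / 2 \<le> - Im D"
      by linarith
    moreover have "Re D = (\<Sum>a\<in>B. ?re a) / b - (\<Sum>a\<in>A. ?re a) / card A"
      "Im D = (\<Sum>a\<in>B. ?im a) / b - (\<Sum>a\<in>A. ?im a) / card A"
      by (simp_all add: D_def)
    moreover have "B \<in> X f \<longleftrightarrow> t / 2 \<le> (\<Sum>a\<in>B. f a) / b - (\<Sum>a\<in>A. f a) / card A" for f
      using B \<open>b > 0\<close> by (auto simp: X_def field_simps)
    ultimately show "B \<in> (X ?re \<union> X (\<lambda>a. - ?re a)) \<union> (X ?im \<union> X (\<lambda>a. - ?im a))"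
      by (auto simp: sum_negf)
  qed
  then have "card ?Y \<le> card ((X ?re \<union> X (\<lambda>a. - ?re a)) \<union> (X ?im \<union> X (\<lambda>a. - ?im a)))"
    by (intro card_mono) (auto simp: fin)
  also have "\<dots> \<le> (card (X ?re) + card (X (\<lambda>a. - ?re a))) + (card (X ?im) + card (X (\<lambda>a. - ?im a)))"
    by (intro order_trans[OF card_Un_le] add_mono card_Un_le)
  finally have "real (card ?Y) \<le> (real (card (X ?re)) + card (X (\<lambda>a. - ?re a)))
      + (real (card (X ?im)) + card (X (\<lambda>a. - ?im a)))"
    by linarith
  also have "\<dots> \<le> 4 * exp (- (b * t\<^sup>2 / 8)) * (card A choose b)"
  proof -
    have "card (X ?re) \<le> exp (- (b * t\<^sup>2 / 8)) * (card A choose b)"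
      "card (X (\<lambda>a. - ?re a)) \<le> exp (- (b * t\<^sup>2 / 8)) * (card A choose b)"
      "card (X ?im) \<le> exp (- (b * t\<^sup>2 / 8)) * (card A choose b)"
      "card (X (\<lambda>a. - ?im a)) \<le> exp (- (b * t\<^sup>2 / 8)) * (card A choose b)"
      by (rule X; simp add: abs_Re_le_cmod abs_Im_le_cmod)+
    then show ?thesis by linarith
  qed
  finally show ?thesis .
qed

section \<open>Averages over k-subsets through random permutations and disjoint blocks\<close>

text \<open>A bijection from \<open>T\<close> to \<open>T'\<close> is glued to one between the
  complements, which have equal size too. This transitivity on subsets of a given size makes the
  image of a fixed subset under a random permutation uniformly distributed.\<close>

lemma exists_permutation_image_eq:
  assumes "finite A" "T \<subseteq> A" "T' \<subseteq> A" "card T = card T'"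
  obtains \<sigma> where "\<sigma> permutes A" "\<sigma> ` T = T'"
proof -
  have "finite T" "finite T'" using assms finite_subset by auto
  then obtain f g where f: "bij_betw f T T'" and g: "bij_betw g (A - T) (A - T')"
    using assms by (metis card_Diff_subset finite_Diff finite_same_card_bij)
  define \<sigma> where "\<sigma> x = (if x \<in> T then f x else if x \<in> A then g x else x)" for x
  have "bij_betw \<sigma> T T'" using f by (subst bij_betw_cong[of _ _ f]) (auto simp: \<sigma>_def)
  moreover have "bij_betw \<sigma> (A - T) (A - T')"
    using g by (subst bij_betw_cong[of _ _ g]) (auto simp: \<sigma>_def)
  ultimately have "bij_betw \<sigma> (T \<union> (A - T)) (T' \<union> (A - T'))"
    by (rule bij_betw_combine) auto
  then have "bij_betw \<sigma> A A"
    using assms by (simp add: Un_absorb1)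
  then have "\<sigma> permutes A"
    using assms by (intro bij_imp_permutes) (auto simp: \<sigma>_def)
  moreover have "\<sigma> ` T = T'" using \<open>bij_betw \<sigma> T T'\<close> by (simp add: bij_betw_def)
  ultimately show thesis by (rule that)
qed

lemma permutes_bij_betw_nsets:
  assumes "p permutes A"
  shows "bij_betw (image p) (nsets A k) (nsets A k)"
  using assms by (intro bij_betw_nsets permutes_imp_bij)

text \<open>The left-hand sum depends on \<open>T\<close> only through \<open>card T\<close>, so it equals its average over \<open>T\<close>.\<close>

lemma sum_permutes_image:
  fixes F :: "'a set \<Rightarrow> 'b::field_char_0"
  assumes "finite A" "T \<in> nsets A k"
  shows "of_nat (card A choose k) * (\<Sum>p | p permutes A. F (p ` T)) = fact (card A) * (\<Sum>S\<in>nsets A k. F S)"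
proof -
  have eq: "(\<Sum>p | p permutes A. F (p ` T)) = (\<Sum>p | p permutes A. F (p ` T'))"
    if T': "T' \<in> nsets A k" for T'
  proof -
    obtain \<sigma> where \<sigma>: "\<sigma> permutes A" "\<sigma> ` T = T'"
    proof (rule exists_permutation_image_eq[of A T T'])
      show "card T = card T'" using T' assms by (simp add: nsets_def)
    qed (use T' assms in \<open>auto simp: nsets_def\<close>)
    have "(\<Sum>p | p permutes A. F (p ` T')) = (\<Sum>p | p permutes A. F ((p \<circ> \<sigma>) ` T))"
      unfolding image_comp[symmetric] \<sigma>(2) ..
    also have "\<dots> = (\<Sum>p | p permutes A. F (p ` T))"
      using sum_permutations_compose_right[OF \<sigma>(1), of "\<lambda>p. F (p ` T)"] by simp
    finally show ?thesis ..
  qed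
  have "of_nat (card A choose k) * (\<Sum>p | p permutes A. F (p ` T))
      = (\<Sum>T'\<in>nsets A k. \<Sum>p | p permutes A. F (p ` T'))"
    by (simp flip: eq)
  also have "\<dots> = (\<Sum>p | p permutes A. \<Sum>T'\<in>nsets A k. F (p ` T'))"
    by (rule sum.swap)
  also have "\<dots> = (\<Sum>p | p permutes A. \<Sum>S\<in>nsets A k. F S)"
    by (intro sum.cong refl sum.reindex_bij_betw) (auto intro: permutes_bij_betw_nsets)
  also have "\<dots> = fact (card A) * (\<Sum>S\<in>nsets A k. F S)"
    using assms by (simp add: card_permutations)
  finally show ?thesis .
qed

text \<open>Multiplying out the product of block means gives an average over the ways to choose one
  point from each block. The blocks are disjoint, so every choice is a k-subset, and a random
  permutation carries it to a uniformly random k-subset. All choices therefore contribute the same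
  average.\<close>

lemma prod_block_means_eq:
  fixes w :: "'a \<Rightarrow> 'b::field_char_0"
  assumes "finite A" and blocks: "\<And>t. t < k \<Longrightarrow> B t \<in> nsets A b"
    and disj: "\<And>s t. s < k \<Longrightarrow> t < k \<Longrightarrow> s \<noteq> t \<Longrightarrow> B s \<inter> B t = {}" and "b > 0"
  shows "fact (card A) * (\<Sum>S\<in>nsets A k. \<Prod>a\<in>S. w a)
    = of_nat (card A choose k) * (\<Sum>p | p permutes A. \<Prod>t<k. (\<Sum>a\<in>p ` B t. w a) / of_nat b)"
proof -
  \<comment> \<open>The choices of one point per block; their number \<open>b ^ k\<close> cancels
    the denominators of the \<open>k\<close> block means.\<close>
  let ?P = "\<Pi>\<^sub>E t\<in>{..<k}. B t"
  have cardP: "card ?P = b ^ k"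
    using blocks by (simp add: card_PiE nsets_def)
  have *: "of_nat (card A choose k) * (\<Sum>p | p permutes A. \<Prod>t<k. w (p (f t)))
      = fact (card A) * (\<Sum>S\<in>nsets A k. \<Prod>a\<in>S. w a)" if f: "f \<in> ?P" for f
  proof -
    have mem: "f t \<in> B t" if "t < k" for t using f that by auto
    have inj: "inj_on f {..<k}"
      by (rule inj_onI) (metis disj disjoint_iff lessThan_iff mem)
    have "f ` {..<k} \<in> nsets A k"
      using inj mem blocks by (auto simp: nsets_def card_image)
    moreover have "(\<Prod>t<k. w (p (f t))) = (\<Prod>a\<in>p ` f ` {..<k}. w a)" if "p permutes A" for p
    proof -
      have "inj_on p (f ` {..<k})" using that by (auto intro: permutes_inj_on)
      then show ?thesis using inj by (simp add: prod.reindex)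
    qed
    ultimately show ?thesis
      using sum_permutes_image[OF assms(1), of "f ` {..<k}" k "\<lambda>S. \<Prod>a\<in>S. w a"] by simp
  qed
  have expand: "(\<Prod>t<k. (\<Sum>a\<in>p ` B t. w a) / of_nat b) = (\<Sum>f\<in>?P. \<Prod>t<k. w (p (f t))) / of_nat b ^ k"
    if "p permutes A" for p
  proof -
    have "(\<Sum>a\<in>p ` B t. w a) = (\<Sum>a\<in>B t. w (p a))" for t
      using that by (subst sum.reindex) (auto intro: permutes_inj_on)
    then show ?thesis
      using blocks by (simp add: prod_dividef) (subst prod_sum_PiE, auto simp: nsets_def)
  qed
  have "of_nat (card A choose k) * (\<Sum>p | p permutes A. \<Prod>t<k. (\<Sum>a\<in>p ` B t. w a) / of_nat b)
      = (\<Sum>f\<in>?P. of_nat (card A choose k) * (\<Sum>p | p permutes A. \<Prod>t<k. w (p (f t)))) / of_nat b ^ k"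
    using sum.swap[of "\<lambda>p f. \<Prod>t<k. w (p (f t))" ?P "{p. p permutes A}"]
    by (simp add: expand flip: sum_divide_distrib sum_distrib_left)
  also have "\<dots> = fact (card A) * (\<Sum>S\<in>nsets A k. \<Prod>a\<in>S. w a)"
    using \<open>b > 0\<close> by (simp add: * cardP)
  finally show ?thesis ..
qed

lemma exists_disjoint_nsets:
  assumes "finite A" "k * b \<le> card A"
  obtains B where "\<And>t. t < k \<Longrightarrow> B t \<in> nsets A b"
    and "\<And>s t. s < k \<Longrightarrow> t < k \<Longrightarrow> s \<noteq> t \<Longrightarrow> B s \<inter> B t = {}"
proof -
  have "\<exists>B. (\<forall>t<k. B t \<in> nsets A b) \<and> (\<forall>s<k. \<forall>t<k. s \<noteq> t \<longrightarrow> B s \<inter> B t = {})"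
    using assms
  proof (induction k arbitrary: A)
    case (Suc k)
    obtain C where C: "C \<subseteq> A" "card C = b" "finite C"
      using Suc.prems by (metis add_leD1 mult_Suc obtain_subset_with_card_n)
    have "k * b \<le> card (A - C)" using C Suc.prems by (simp add: card_Diff_subset)
    then obtain B where B: "\<forall>t<k. B t \<in> nsets (A - C) b"
      "\<forall>s<k. \<forall>t<k. s \<noteq> t \<longrightarrow> B s \<inter> B t = {}"
      using Suc.IH[of "A - C"] Suc.prems by auto
    have BC: "B t \<inter> C = {}" "B t \<in> nsets A b" if "t < k" for t
      using B(1) that by (auto simp: nsets_def)
    show ?case
    proof (intro exI[of _ "B(k := C)"] conjI allI impI)
      fix t assume "t < Suc k"
      then show "(B(k := C)) t \<in> nsets A b"
        using C BC by (cases "t = k") (auto simp: nsets_def)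
    next
      fix s t assume "s < Suc k" "t < Suc k" "s \<noteq> t"
      then show "(B(k := C)) s \<inter> (B(k := C)) t = {}"
        using B(2) BC(1) by (auto simp: less_Suc_eq)
    qed
  qed auto
  then show thesis using that by blast
qed


text \<open>For each permutation either all \<open>k\<close> block means are at most
  \<open>d + \<zeta>\<close> in modulus, or some block is bad; in the latter case the product, being
  at most 1, is dominated by the number of bad blocks. Each permuted block is a uniformly random
  \<open>b\<close>-subset, so Hoeffding bounds its chance of being bad, and summing over the
  \<open>k\<close> blocks gives the error term.\<close>

lemma norm_sum_nsets_prod_le:
  fixes w :: "'a \<Rightarrow> complex" and d \<zeta> :: real
  assumes "finite A" "0 < k" "k \<le> card A" and w: "\<And>a. a \<in> A \<Longrightarrow> cmod (w a) \<le> 1"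
    and d: "cmod ((\<Sum>a\<in>A. w a) / card A) \<le> d" and "\<zeta> \<ge> 0"
  shows "cmod (\<Sum>S\<in>nsets A k. \<Prod>a\<in>S. w a)
    \<le> (card A choose k) * ((d + \<zeta>) ^ k + 4 * k * exp (- ((card A div k) * \<zeta>\<^sup>2 / 8)))"
proof -
  define l b where "l = card A" and "b = card A div k"
  have "b > 0" "k * b \<le> card A" using assms by (auto simp: b_def div_greater_zero_iff)
  have "A \<noteq> {}" using assms by auto
  obtain B where B: "\<And>t. t < k \<Longrightarrow> B t \<in> nsets A b"
    "\<And>s t. s < k \<Longrightarrow> t < k \<Longrightarrow> s \<noteq> t \<Longrightarrow> B s \<inter> B t = {}"
    using exists_disjoint_nsets[OF assms(1) \<open>k * b \<le> card A\<close>] by blast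
  define y where "y S = cmod ((\<Sum>a\<in>S. w a) / of_nat b)" for S
  define bad :: "'a set \<Rightarrow> real" where "bad S = of_bool (y S > d + \<zeta>)" for S
  define \<delta> where "\<delta> = 4 * exp (- (b * \<zeta>\<^sup>2 / 8))"
  have d0: "d \<ge> 0" using d norm_ge_zero order_trans by blast
  have y1: "y S \<le> 1" if "S \<in> nsets A b" for S
  proof -
    have "cmod (\<Sum>a\<in>S. w a) \<le> (\<Sum>a\<in>S. 1)"
      using that w by (intro sum_norm_le) (auto simp: nsets_def)
    then show ?thesis using that \<open>b > 0\<close> by (simp add: y_def nsets_def norm_divide)
  qed
  have prod_le: "(\<Prod>t<k. y (p ` B t)) \<le> (d + \<zeta>) ^ k + (\<Sum>t<k. bad (p ` B t))" if "p permutes A" for p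
  proof (cases "\<exists>t<k. y (p ` B t) > d + \<zeta>")
    case True
    then obtain t where t: "t < k" "bad (p ` B t) = 1" by (auto simp: bad_def)
    have "(\<Prod>t<k. y (p ` B t)) \<le> 1"
      using B(1) permutes_bij_betw_nsets[OF that, of b] y1
      by (intro prod_le_1) (auto simp: y_def dest: bij_betwE)
    also have "\<dots> \<le> (\<Sum>t<k. bad (p ` B t))"
      unfolding t(2)[symmetric] using t(1) by (intro member_le_sum) (auto simp: bad_def)
    finally show ?thesis using d0 \<open>\<zeta> \<ge> 0\<close> by (simp add: add_increasing)
  next
    case False
    then have "(\<Prod>t<k. y (p ` B t)) \<le> (\<Prod>t<k. d + \<zeta>)"
      by (intro prod_mono) (fastforce simp: y_def not_less)
    then show ?thesis by (simp add: add_increasing2 sum_nonneg bad_def)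
  qed
  have sum_bad: "(\<Sum>p | p permutes A. bad (p ` B t)) \<le> fact l * \<delta>" if "t < k" for t
  proof -
    have "(l choose b) * (\<Sum>p | p permutes A. bad (p ` B t)) = fact l * (\<Sum>S\<in>nsets A b. bad S)"
      using sum_permutes_image[OF assms(1) B(1)[OF that]] by (simp add: l_def)
    also have "(\<Sum>S\<in>nsets A b. bad S) = card {S \<in> nsets A b. y S > d + \<zeta>}"
      using assms(1) by (simp add: bad_def of_bool_def sum.If_cases finite_imp_finite_nsets Int_def)
    \<comment> \<open>Lowering the threshold from \<open>d\<close> to the actual modulus of the mean
      only enlarges the set, and puts it in the form that the concentration bound handles.\<close>
    also have "\<dots> \<le> card {S \<in> nsets A b. y S > cmod ((\<Sum>a\<in>A. w a) / card A) + \<zeta>}"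
      using assms(1) d by (intro of_nat_mono card_mono) (auto simp: finite_imp_finite_nsets)
    also have "\<dots> \<le> \<delta> * (l choose b)"
      unfolding y_def \<delta>_def l_def
      by (rule complex_Hoeffding_without_replacement)
        (use assms \<open>A \<noteq> {}\<close> \<open>b > 0\<close> in auto)
    finally have "(l choose b) * (\<Sum>p | p permutes A. bad (p ` B t)) \<le> (l choose b) * (fact l * \<delta>)"
      by (simp add: mult_ac)
    moreover have "l choose b > 0" by (simp add: l_def b_def)
    ultimately show ?thesis by simp
  qed
  have "fact l * cmod (\<Sum>S\<in>nsets A k. \<Prod>a\<in>S. w a)
      = (l choose k) * cmod (\<Sum>p | p permutes A. \<Prod>t<k. (\<Sum>a\<in>p ` B t. w a) / of_nat b)"
    using prod_block_means_eq[OF assms(1) B \<open>b > 0\<close>, where w = w, THEN arg_cong[where f = cmod]]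
    by (simp add: norm_mult l_def)
  also have "\<dots> \<le> (l choose k) * (\<Sum>p | p permutes A. \<Prod>t<k. y (p ` B t))"
    unfolding y_def prod_norm by (intro mult_left_mono norm_sum) auto
  also have "\<dots> \<le> (l choose k) * (\<Sum>p | p permutes A. (d + \<zeta>) ^ k + (\<Sum>t<k. bad (p ` B t)))"
    using prod_le by (intro mult_left_mono sum_mono) auto
  also have "(\<Sum>p | p permutes A. (d + \<zeta>) ^ k + (\<Sum>t<k. bad (p ` B t)))
      = fact l * (d + \<zeta>) ^ k + (\<Sum>t<k. \<Sum>p | p permutes A. bad (p ` B t))"
    using assms(1) sum.swap[of "\<lambda>p t. bad (p ` B t)" "{..<k}" "{p. p permutes A}"]
    by (simp add: sum.distrib card_permutations l_def)
  also have "\<dots> \<le> fact l * (d + \<zeta>) ^ k + (\<Sum>t<k. fact l * \<delta>)"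
    using sum_bad by (intro add_left_mono sum_mono) auto
  also have "\<dots> = fact l * ((d + \<zeta>) ^ k + k * \<delta>)"
    by (simp add: algebra_simps)
  finally have "fact l * cmod (\<Sum>S\<in>nsets A k. \<Prod>a\<in>S. w a)
      \<le> fact l * ((l choose k) * ((d + \<zeta>) ^ k + k * \<delta>))"
    by (simp add: mult_ac mult_right_mono)
  then show ?thesis
    by (simp add: l_def b_def \<delta>_def mult_ac)
qed

section \<open>Fourier inversion on the residues modulo r\<close>

lemma primitive_root_of_unity_nonzero:
  assumes "primitive_root_of_unity r \<omega>" "r > 0"
  shows "\<omega> \<noteq> 0"
  using assms by (auto simp: primitive_root_of_unity_def power_0_left split: if_splits)

lemma cmod_primitive_root_of_unity_powi:
  assumes "primitive_root_of_unity r \<omega>" "r > 0"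
  shows "cmod (\<omega> powi s) = 1"
proof -
  have "cmod \<omega> ^ r = 1"
    using assms by (simp add: primitive_root_of_unity_def flip: norm_power)
  then have "cmod \<omega> = 1"
    using assms(2) power_eq_1_iff[of "cmod \<omega>" r] by simp
  then show ?thesis by (simp add: norm_power_int)
qed

text \<open>Since \<open>\<omega> ^ r = 1\<close>, the exponent, possibly negative, can be replaced
  by its residue modulo \<open>r\<close>; primitivity then excludes every nonzero residue.\<close>

lemma primitive_root_of_unity_powi_eq_1_iff:
  assumes \<omega>: "primitive_root_of_unity r \<omega>" and "r > 0"
  shows "\<omega> powi s = 1 \<longleftrightarrow> int r dvd s"
proof -
  define j where "j = nat (s mod int r)"
  have j: "int j = s mod int r" "j < r" using \<open>r > 0\<close> by (auto simp: j_def nat_less_iff)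
  have "s = int r * (s div int r) + int j" by (simp add: j)
  moreover have "\<omega> powi (int r * (s div int r) + int j) = \<omega> ^ j"
    using \<omega> primitive_root_of_unity_nonzero[OF assms]
    by (simp add: power_int_add power_int_mult primitive_root_of_unity_def)
  ultimately have "\<omega> powi s = \<omega> ^ j" by simp
  moreover have "\<omega> ^ j = 1 \<longleftrightarrow> j = 0"
    using \<omega> j(2) by (cases "j = 0") (auto simp: primitive_root_of_unity_def)
  moreover have "int r dvd s \<longleftrightarrow> j = 0"
    using j(1) by (simp add: dvd_eq_mod_eq_0 flip: j(1))
  ultimately show ?thesis by simp
qed

text \<open>Orthogonality of characters: this is a geometric sum with ratio
  \<open>\<omega> powi s\<close>, whose \<open>r\<close>-th power is 1, so it vanishes unless the
  ratio is 1.\<close>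

lemma sum_primitive_root_of_unity_powi:
  assumes \<omega>: "primitive_root_of_unity r \<omega>" and "r > 0"
  shows "(\<Sum>j<r. \<omega> powi (int j * s)) = (if int r dvd s then of_nat r else 0)"
proof -
  have eq: "\<omega> powi (int j * s) = (\<omega> powi s) ^ j" for j
    by (simp add: power_int_power' mult.commute)
  have "(\<omega> powi s) ^ r = 1"
    using primitive_root_of_unity_powi_eq_1_iff[OF assms, of "s * int r"]
    by (simp add: power_int_power')
  then show ?thesis
    using primitive_root_of_unity_powi_eq_1_iff[OF assms, of s]
    by (simp add: eq sum_gp_strict)
qed

lemma power_int_sum:
  fixes x :: "'a::field"
  assumes "x \<noteq> 0"
  shows "x powi (\<Sum>i\<in>S. f i) = (\<Prod>i\<in>S. x powi f i)"
  using assms by (induction S rule: infinite_finite_induct) (auto simp: power_int_add)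

text \<open>Colors start at 1, so color \<open>c\<close> stands for the residue
  \<open>c - 1\<close>. The divisibility form is the one that orthogonality detects.\<close>

lemma sum_coloring_eq_iff:
  assumes "c \<in> {1..r}"
  shows "sum_coloring r z S = c \<longleftrightarrow> int r dvd (\<Sum>i\<in>S. z i) - (int c - 1)"
proof -
  have "sum_coloring r z S = c \<longleftrightarrow> (\<Sum>i\<in>S. z i) mod int r = int c - 1"
    using assms by (auto simp: sum_coloring_def)
  also have "\<dots> \<longleftrightarrow> (\<Sum>i\<in>S. z i) mod int r = (int c - 1) mod int r"
    using assms by simp
  finally show ?thesis by (simp add: mod_eq_dvd_iff)
qed

text \<open>Orthogonality writes \<open>r\<close> times the indicator of color \<open>c\<close> as a
  sum over frequencies \<open>j\<close>. Frequency 0 yields the expected count, and every other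
  frequency enters with a phase of modulus 1, which the triangle inequality discards.\<close>

lemma card_color_class_deviation_le:
  assumes \<omega>: "primitive_root_of_unity r \<omega>" and "finite A" "c \<in> {1..r}"
  shows "\<bar>real r * card (sum_coloring r z -` {c} \<inter> nsets A k) - (card A choose k)\<bar>
    \<le> (\<Sum>j\<in>{1..r-1}. cmod (\<Sum>S\<in>nsets A k. \<Prod>i\<in>S. \<omega> powi (int j * z i)))"
proof -
  have "r > 0" using assms(3) by auto
  have nz: "\<omega> \<noteq> 0" by (rule primitive_root_of_unity_nonzero[OF \<omega> \<open>r > 0\<close>])
  have fin: "finite (nsets A k)" using assms by (simp add: finite_imp_finite_nsets)
  define N where "N = card (sum_coloring r z -` {c} \<inter> nsets A k)"
  define E where "E j = (\<Sum>S\<in>nsets A k. \<Prod>i\<in>S. \<omega> powi (int j * z i))" for j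
  \<comment> \<open>The phase that carries the whole dependence on the color; it is constant in
    \<open>S\<close> and so factors out of the sum over subsets.\<close>
  define u where "u j = \<omega> powi - (int j * (int c - 1))" for j
  have "of_nat r * of_nat N = (\<Sum>S\<in>nsets A k. if sum_coloring r z S = c then of_nat r else (0::complex))"
    using fin by (simp add: sum.If_cases N_def vimage_def Int_commute)
  also have "\<dots> = (\<Sum>S\<in>nsets A k. \<Sum>j<r. \<omega> powi (int j * ((\<Sum>i\<in>S. z i) - (int c - 1))))"
    by (simp add: sum_coloring_eq_iff[OF assms(3)] sum_primitive_root_of_unity_powi[OF \<omega> \<open>r > 0\<close>])
  also have "\<dots> = (\<Sum>S\<in>nsets A k. \<Sum>j<r. u j * (\<Prod>i\<in>S. \<omega> powi (int j * z i)))"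
  proof (intro sum.cong refl)
    fix S j
    have "int j * ((\<Sum>i\<in>S. z i) - (int c - 1)) = - (int j * (int c - 1)) + (\<Sum>i\<in>S. int j * z i)"
      by (simp add: algebra_simps sum_distrib_left)
    then show "\<omega> powi (int j * ((\<Sum>i\<in>S. z i) - (int c - 1))) = u j * (\<Prod>i\<in>S. \<omega> powi (int j * z i))"
      using nz by (simp only: u_def power_int_add power_int_sum simp_thms)
  qed
  also have "\<dots> = (\<Sum>j<r. u j * E j)"
    unfolding E_def sum_distrib_left by (rule sum.swap)
  also have "{..<r} = insert 0 {1..r-1}" using \<open>r > 0\<close> by auto
  also have "(\<Sum>j\<in>insert 0 {1..r-1}. u j * E j) = of_nat (card A choose k) + (\<Sum>j\<in>{1..r-1}. u j * E j)"
    by (subst sum.insert) (auto simp: u_def E_def)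
  finally have "of_real (real r * N - (card A choose k)) = (\<Sum>j\<in>{1..r-1}. u j * E j)"
    by simp
  then have "\<bar>real r * N - (card A choose k)\<bar> = cmod (\<Sum>j\<in>{1..r-1}. u j * E j)"
    by (metis norm_of_real)
  also have "\<dots> \<le> (\<Sum>j\<in>{1..r-1}. cmod (u j * E j))" by (rule norm_sum)
  also have "\<dots> = (\<Sum>j\<in>{1..r-1}. cmod (E j))"
    by (simp add: u_def norm_mult cmod_primitive_root_of_unity_powi[OF \<omega> \<open>r > 0\<close>])
  finally show ?thesis by (simp add: N_def E_def)
qed

lemma balanced_on_sum_coloring:
  fixes \<eta> :: real
  assumes \<omega>: "primitive_root_of_unity r \<omega>" and "finite A" "r > 0"
    and E: "\<And>j. j \<in> {1..r-1} \<Longrightarrow>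
      cmod (\<Sum>S\<in>nsets A k. \<Prod>i\<in>S. \<omega> powi (int j * z i)) \<le> (card A choose k) * \<eta>"
    and "r * \<eta> \<le> \<epsilon>" "\<eta> \<ge> 0"
  shows "balanced_on k r (sum_coloring r z) \<epsilon> A"
  unfolding balanced_on_def
proof
  fix c assume c: "c \<in> {1..r}"
  let ?N = "real (card (sum_coloring r z -` {c} \<inter> nsets A k))" and ?C = "real (card A choose k)"
  have "\<bar>r * ?N - ?C\<bar> \<le> (\<Sum>j\<in>{1..r-1}. cmod (\<Sum>S\<in>nsets A k. \<Prod>i\<in>S. \<omega> powi (int j * z i)))"
    by (rule card_color_class_deviation_le[OF \<omega> assms(2) c])
  also have "\<dots> \<le> (\<Sum>j\<in>{1..r-1}. ?C * \<eta>)" by (rule sum_mono) (rule E)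
  also have "\<dots> = real (r - 1) * (?C * \<eta>)" by simp
  also have "\<dots> \<le> r * (?C * \<eta>)"
    using \<open>\<eta> \<ge> 0\<close> by (intro mult_right_mono) auto
  also have "\<dots> = ?C * (r * \<eta>)" by simp
  also have "\<dots> \<le> ?C * \<epsilon>" using assms(5) by (intro mult_left_mono) auto
  finally have "\<bar>r * ?N - ?C\<bar> \<le> ?C * \<epsilon>" .
  then show "(1 - \<epsilon>) / r * ?C \<le> ?N \<and> ?N \<le> (1 + \<epsilon>) / r * ?C"
    using \<open>r > 0\<close> by (auto simp: abs_le_iff field_simps)
qed

section \<open>Balance of the sum coloring: union bound over the nonzero frequencies\<close>

theorem theorem3p8:
  fixes n m k r :: nat and z :: "nat \<Rightarrow> int" and \<omega> :: complex and \<beta> \<zeta> :: real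
  assumes "n \<ge> m" and "m \<ge> k" and "k \<ge> 1" and "r \<ge> 2"
    and "primitive_root_of_unity r \<omega>"
    and "\<beta> \<in> {0..1}" and "\<zeta> \<in> {0..1}"
  shows "balanced n k r (sum_coloring r z)
           (4 * real r ^ 2 * real k * exp (- (real_of_int \<lfloor>real m / real k\<rfloor> * \<zeta> ^ 2 / 8))
              + real r * (disc r \<omega> n z + \<beta> + \<zeta>) ^ k)
           (4 * real r * exp (- (real m * \<beta> ^ 2 / 8)))
           m"
  unfolding balanced_def
proof
  fix l assume l: "l \<in> {m..n}"
  let ?\<epsilon> = "4 * real r ^ 2 * real k * exp (- (real_of_int \<lfloor>real m / real k\<rfloor> * \<zeta> ^ 2 / 8))
              + real r * (disc r \<omega> n z + \<beta> + \<zeta>) ^ k"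
  let ?\<Omega> = "nsets {1..n} l" and ?G = "{A. balanced_on k r (sum_coloring r z) ?\<epsilon> A}"
  define w where "w j i = \<omega> powi (int j * z i)" for j i
  \<comment> \<open>The sets whose mean at frequency \<open>j\<close> exceeds in modulus that of the
    whole ground set by more than \<open>\<beta>\<close>; outside them the mean is at most
    \<open>disc r \<omega> n z + \<beta>\<close>, which serves as \<open>d\<close> in the block
    estimate.\<close>
  define bad where "bad j = {A \<in> ?\<Omega>. cmod ((\<Sum>i\<in>A. w j i) / l)
    > cmod ((\<Sum>i\<in>{1..n}. w j i) / card {1..n}) + \<beta>}" for j
  have w: "cmod (w j i) \<le> 1" for j i
    using assms by (simp add: w_def cmod_primitive_root_of_unity_powi)
  have "l > 0" using l assms by auto
  have fin: "finite ?\<Omega>" by (simp add: finite_imp_finite_nsets)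
  have C: "card ?\<Omega> > 0" using l by simp
  then have ne: "?\<Omega> \<noteq> {}" using card_gt_0_iff by blast
  have disc: "cmod ((\<Sum>i\<in>{1..n}. w j i) / card {1..n}) \<le> disc r \<omega> n z" if "j \<in> {1..r-1}" for j
    unfolding disc_def using that by (intro Max_ge) (auto simp: w_def)
  have good: "A \<in> ?G" if A: "A \<in> ?\<Omega>" and good: "\<And>j. j \<in> {1..r-1} \<Longrightarrow> A \<notin> bad j" for A
  proof -
    let ?\<eta> = "(disc r \<omega> n z + \<beta> + \<zeta>) ^ k + 4 * k * exp (- ((l div k) * \<zeta>\<^sup>2 / 8))"
    have A': "finite A" "card A = l" using A by (auto simp: nsets_def)
    have mean: "cmod ((\<Sum>i\<in>A. w j i) / card A) \<le> disc r \<omega> n z + \<beta>" if "j \<in> {1..r-1}" for j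
      using good[OF that] A disc[OF that] A' by (auto simp: bad_def)
    \<comment> \<open>As \<open>r \<ge> 2\<close> there is a nonzero frequency, and the bound on the
      mean at that frequency shows that \<open>disc r \<omega> n z + \<beta>\<close> is
      nonnegative.\<close>
    have "1 \<in> {1..r-1}" using assms by auto
    then have "0 \<le> disc r \<omega> n z + \<beta>" using mean norm_ge_zero order_trans by blast
    then have \<eta>0: "0 \<le> (disc r \<omega> n z + \<beta> + \<zeta>) ^ k" using assms by (intro zero_le_power) auto
    \<comment> \<open>Larger samples have larger blocks, so the error term is worst at
      \<open>l = m\<close>.\<close>
    have "exp (- ((l div k) * \<zeta>\<^sup>2 / 8)) \<le> exp (- ((m div k) * \<zeta>\<^sup>2 / 8))"
      using l by (auto intro!: divide_right_mono mult_right_mono div_le_mono)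
    then have "r * (4 * k * exp (- ((l div k) * \<zeta>\<^sup>2 / 8))) \<le> r * (4 * k * exp (- ((m div k) * \<zeta>\<^sup>2 / 8)))"
      by (intro mult_left_mono) auto
    \<comment> \<open>Multiplication by one more factor \<open>r \<ge> 1\<close> reaches the
      \<open>r ^ 2\<close> in \<open>?\<epsilon>\<close>.\<close>
    also have "\<dots> \<le> real r * (r * (4 * k * exp (- ((m div k) * \<zeta>\<^sup>2 / 8))))"
      using assms by (intro mult_left_mono) auto
    finally have "r * ?\<eta> \<le> ?\<epsilon>"
      by (simp add: algebra_simps power2_eq_square floor_divide_of_nat_eq)
    moreover have "cmod (\<Sum>S\<in>nsets A k. \<Prod>i\<in>S. \<omega> powi (int j * z i)) \<le> (card A choose k) * ?\<eta>"
      if "j \<in> {1..r-1}" for j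
      using norm_sum_nsets_prod_le[OF A'(1) _ _ _ mean[OF that], of k \<zeta>] A'(2) w l assms
      by (simp add: w_def)
    ultimately have "balanced_on k r (sum_coloring r z) ?\<epsilon> A"
      using assms A'(1) \<eta>0 by (intro balanced_on_sum_coloring[where \<eta> = ?\<eta>]) auto
    then show ?thesis by simp
  qed
  have bad: "card (bad j) \<le> 4 * exp (- (m * \<beta>\<^sup>2 / 8)) * card ?\<Omega>" for j
  proof -
    have "card (bad j) \<le> 4 * exp (- (l * \<beta>\<^sup>2 / 8)) * (card {1..n} choose l)"
      unfolding bad_def using w assms \<open>l > 0\<close>
      by (intro complex_Hoeffding_without_replacement) auto
    also have "\<dots> \<le> 4 * exp (- (m * \<beta>\<^sup>2 / 8)) * (card {1..n} choose l)"
      using l by (intro mult_right_mono mult_left_mono)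
        (auto intro!: divide_right_mono mult_right_mono)
    finally show ?thesis by simp
  qed
  \<comment> \<open>Contrapositive of \<open>good\<close>: an unbalanced set is bad at some nonzero
    frequency. The union bound runs over \<open>r - 1\<close> frequencies, rounded up to
    \<open>r\<close> to match the stated failure probability.\<close>
  have "?\<Omega> - ?G \<subseteq> (\<Union>j\<in>{1..r-1}. bad j)" using good by blast
  then have "card (?\<Omega> - ?G) \<le> card (\<Union>j\<in>{1..r-1}. bad j)"
    using fin by (intro card_mono) (auto simp: bad_def)
  also have "\<dots> \<le> (\<Sum>j\<in>{1..r-1}. card (bad j))" by (rule card_UN_le) simp
  finally have "real (card (?\<Omega> - ?G)) \<le> (\<Sum>j\<in>{1..r-1}. real (card (bad j)))"
    by (metis of_nat_mono of_nat_sum)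
  also have "\<dots> \<le> (\<Sum>j\<in>{1..r-1}. 4 * exp (- (m * \<beta>\<^sup>2 / 8)) * card ?\<Omega>)"
    using bad by (rule sum_mono)
  also have "\<dots> = real (r - 1) * (4 * exp (- (m * \<beta>\<^sup>2 / 8)) * card ?\<Omega>)" by simp
  also have "\<dots> \<le> r * (4 * exp (- (m * \<beta>\<^sup>2 / 8)) * card ?\<Omega>)"
    by (intro mult_right_mono) auto
  finally have "real (card (?\<Omega> - ?G)) \<le> 4 * real r * exp (- (m * \<beta>\<^sup>2 / 8)) * card ?\<Omega>"
    by (simp only: mult_ac)
  moreover have "real (card ?\<Omega>) = card (?\<Omega> \<inter> ?G) + card (?\<Omega> - ?G)"
    by (metis card_Int_Diff fin of_nat_add)
  ultimately have "(1 - 4 * real r * exp (- (m * \<beta>\<^sup>2 / 8))) * card ?\<Omega> \<le> card (?\<Omega> \<inter> ?G)"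
    by (simp add: algebra_simps)
  then show "1 - 4 * real r * exp (- (real m * \<beta> ^ 2 / 8)) \<le> measure_pmf.prob (pmf_of_set ?\<Omega>) ?G"
    using C by (subst measure_pmf_of_set[OF ne fin]) (simp add: pos_le_divide_eq del: card_nsets)
qed

end
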